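(* Let $V$ be a nonzero finite-dimensional real vector space, and let $\mathcal{Q}(V)$ denote the finite-dimensional real vector space of all homogeneous quadratic maps $Q : V \to V$. Then there exists a proper algebraic subvariety $Z \subsetneq \mathcal{Q}(V)$ such that for every $Q \in \mathcal{Q}(V) \setminus Z$ there is an initial condition $A \in V$ for which the solution of the ODE $$\frac{dX}{dt} = Q(X), \qquad X(0) = A,$$ blows up in finite time.
   Context: A map $Q : V \to V$ is homogeneous quadratic if $Q(X) = B(X,X)$ for some symmetric bilinear map $B : V \times V \to V$; equivalently, in linear coordinates on $V$ each component of $Q$ is a homogeneous polynomial of degree $2$ (or zero). These maps form a finite-dimensional real vector space $\mathcal{Q}(V)$ under pointwise operations. An algebraic subvariety of $\mathcal{Q}(V)$ is the common zero set of a collection of real polynomial functions in linear coordinates on $\mathcal{Q}(V)$; it is proper if it is not all of $\mathcal{Q}(V)$. The solution with initial condition $X(0)=A$ blows up in finite time if there is a finite $T > 0$ such that the solution exists on $[0,T)$ and $\|X(t)\| \to \infty$ as $t \to T^-$, where $\|\cdot\|$ is any norm on $V$. *)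

theory Defs
  imports "HOL-Analysis.Analysis"
begin

definition quadratic_maps :: "('a::real_vector \<Rightarrow> 'a) set" where
  "quadratic_maps =
     {Q. \<exists>B. bilinear B \<and> (\<forall>x y. B x y = B y x) \<and> (\<forall>x. Q x = B x x)}"

(* Only the values of l on quadratic_maps matter; the vector space operations
   on maps are the pointwise ones. *)
definition linear_functional :: "(('a::real_vector \<Rightarrow> 'a) \<Rightarrow> real) \<Rightarrow> bool" where
  "linear_functional l \<longleftrightarrow>
     (\<forall>P\<in>quadratic_maps. \<forall>Q\<in>quadratic_maps. l (\<lambda>x. P x + Q x) = l P + l Q) \<and>
     (\<forall>c. \<forall>Q\<in>quadratic_maps. l (\<lambda>x. c *\<^sub>R Q x) = c * l Q)"

(* The unique-existence condition says that Q \<mapsto> (\<phi> 0 Q, ..., \<phi> (N - 1) Q) is a bijection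
   from quadratic_maps onto R^N; the values c i with i \<ge> N are irrelevant. *)
definition linear_coordinates ::
    "nat \<Rightarrow> (nat \<Rightarrow> ('a::real_vector \<Rightarrow> 'a) \<Rightarrow> real) \<Rightarrow> bool" where
  "linear_coordinates N \<phi> \<longleftrightarrow>
     (\<forall>i<N. linear_functional (\<phi> i)) \<and>
     (\<forall>c :: nat \<Rightarrow> real. \<exists>!Q. Q \<in> quadratic_maps \<and> (\<forall>i<N. \<phi> i Q = c i))"

(* M is the finite set of exponent vectors and a m the coefficient of the monomial with
   exponents m. Any two linear coordinate systems differ by an invertible linear
   substitution, so the choice of coordinates does not affect the notion. *)
definition polynomial_on_quadratic_maps :: "(('a::real_vector \<Rightarrow> 'a) \<Rightarrow> real) \<Rightarrow> bool" where
  "polynomial_on_quadratic_maps f \<longleftrightarrow>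
     (\<exists>N \<phi>. linear_coordinates N \<phi> \<and>
       (\<exists>(M :: (nat \<Rightarrow> nat) set) (a :: (nat \<Rightarrow> nat) \<Rightarrow> real). finite M \<and>
         (\<forall>Q\<in>quadratic_maps. f Q = (\<Sum>m\<in>M. a m * (\<Prod>i<N. \<phi> i Q ^ m i)))))"

definition algebraic_subvariety :: "('a::real_vector \<Rightarrow> 'a) set \<Rightarrow> bool" where
  "algebraic_subvariety Z \<longleftrightarrow>
     (\<exists>F. (\<forall>f\<in>F. polynomial_on_quadratic_maps f) \<and>
          Z = {Q \<in> quadratic_maps. \<forall>f\<in>F. f Q = 0})"

(* A quadratic map on a finite-dimensional space is locally Lipschitz, so a solution X on
   {0..<T} is unique and "the solution" may be introduced existentially. At t = 0 the
   derivative is one-sided. *)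
definition blows_up_in_finite_time ::
    "('a::real_normed_vector \<Rightarrow> 'a) \<Rightarrow> 'a \<Rightarrow> bool" where
  "blows_up_in_finite_time Q A \<longleftrightarrow>
     (\<exists>T>0. \<exists>X :: real \<Rightarrow> 'a.
        X 0 = A \<and>
        (\<forall>t\<in>{0..<T}. (X has_vector_derivative Q (X t)) (at t within {0..<T})) \<and>
        filterlim (\<lambda>t. norm (X t)) at_top (at_left T))"

end

theory Submission
  imports Defs "HOL-Homology.Brouwer_Degree" "Jordan_Normal_Form.Determinant"
begin

text \<open>
If \<open>Q A = l A\<close> with \<open>A \<noteq> 0\<close> and \<open>l > 0\<close>, then \<open>Q\<close> is tangent to the ray through \<open>A\<close>, the equation
restricted to that ray is \<open>r' = l r\<^sup>2\<close>, and its solution \<open>r = 1 / (1 - l t)\<close> blows up at time \<open>1 / l\<close>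
(\<open>blows_up_along_ray\<close>). So it suffices that a generic \<open>Q\<close> has such an invariant ray.

The generic condition is that \<open>Q\<close> has no nonzero real zero. Under it \<open>q x = Q x / |Q x|\<close> is a
self-map of the unit sphere, and \<open>q (- x) = q x\<close> because \<open>Q\<close> is homogeneous of even degree. A self-map
of the sphere without fixed point is homotopic to the antipodal map by pushing along great
circles, so its degree is \<open>\<plusminus>1\<close>; but an even self-map has even degree. Hence \<open>q\<close> has a fixed
point, which spans the invariant ray (\<open>quadratic_ray\<close>).

That even maps have even degree (\<open>even_Brouwer_degree2_even_map\<close>) is proved by cutting the
fundamental class along the equator into a lower and an upper hemisphere. The antipodal map carries
one hemisphere to the other up to sign, and an even map does not notice the antipodal map, so the
two halves contribute the same image up to sign and the total is either zero or twice something.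
The argument lives in the homology of the sphere relative to a contractible set containing the image
of the equator. For \<open>q\<close> such a set is available: \<open>Q\<close> is smooth and hyperplanes are null sets, so
\<open>q\<close> misses some point on the equator, and a punctured sphere is contractible.

The maps \<open>Q\<close> that do have a nonzero real zero \<open>x\<close> must be enclosed in an algebraic hypersurface
(\<open>degeneracy_polynomial\<close>). Let \<open>n\<close> be the dimension. Each monomial of degree \<open>n + 1\<close> is divisible by
the square of some coordinate \<open>x\<^sub>i\<close>; replacing that square by the quadratic form \<open>Q\<^sub>i\<close> and
expanding in monomials gives one row of a square matrix, linear in \<open>Q\<close>, as in Macaulay's
construction of the resultant. A nonzero zero \<open>x\<close> of \<open>Q\<close> makes the vector of all monomials
evaluated at \<open>x\<close> a nonzero kernel vector, so the determinant vanishes, whereas for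
\<open>Q\<^sub>i = x\<^sub>i\<^sup>2\<close> the matrix is the identity and the determinant is 1.
\<close>

no_notation scalar_prod (infix "\<bullet>" 70)

section \<open>Polarization of quadratic maps\<close>

text \<open>
The polar form of \<open>Q\<close> is the unique symmetric bilinear map that restricts to \<open>Q\<close> on the diagonal. Writing
it explicitly in \<open>Q\<close> makes its values linear in \<open>Q\<close>, which is what coordinates on the space of
quadratic maps require.
\<close>
definition polar :: "('a::real_vector \<Rightarrow> 'a) \<Rightarrow> 'a \<Rightarrow> 'a \<Rightarrow> 'a" where
  "polar Q u v = (1/2) *\<^sub>R (Q (u + v) - Q u - Q v)"

lemma polar_eq:
  assumes "bilinear B" "\<And>x y. B x y = B y x" "\<And>x. Q x = B x x"
  shows "polar Q u v = B u v"
proof -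
  have "Q (u + v) - Q u - Q v = 2 *\<^sub>R B u v"
    using assms(1) by (simp add: assms(2)[of v u] assms(3) bilinear_ladd bilinear_radd scaleR_2)
  then show ?thesis
    by (simp add: polar_def)
qed

lemma polar_quadratic:
  assumes "Q \<in> quadratic_maps"
  shows bilinear_polar: "bilinear (polar Q)"
    and polar_commute: "polar Q u v = polar Q v u"
    and polar_diagonal: "polar Q u u = Q u"
proof -
  obtain B where B: "bilinear B" "\<And>x y. B x y = B y x" "\<And>x. Q x = B x x"
    using assms by (auto simp: quadratic_maps_def)
  have eq: "polar Q = B"
    using polar_eq[OF B] by (intro ext)
  show "bilinear (polar Q)" "polar Q u v = polar Q v u" "polar Q u u = Q u"
    using B unfolding eq by simp_all
qed

lemma quadratic_mapI:
  "bilinear B \<Longrightarrow> (\<And>x y. B x y = B y x) \<Longrightarrow> (\<lambda>x. B x x) \<in> quadratic_maps"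
  by (auto simp: quadratic_maps_def)

lemma quadratic_scaleR:
  assumes "Q \<in> quadratic_maps"
  shows "Q (c *\<^sub>R x) = c\<^sup>2 *\<^sub>R Q x"
  using bilinear_polar[OF assms]
  by (simp add: bilinear_lmul bilinear_rmul power2_eq_square flip: polar_diagonal[OF assms])

lemma quadratic_minus:
  assumes "Q \<in> quadratic_maps"
  shows "Q (- x) = Q x"
  using quadratic_scaleR[OF assms, of "-1" x] by simp

lemma quadratic_differentiable:
  fixes Q :: "'a::euclidean_space \<Rightarrow> 'a"
  assumes "Q \<in> quadratic_maps"
  shows "Q differentiable_on S"
proof -
  interpret bounded_bilinear "polar Q"
    using bilinear_polar[OF assms] by (simp add: bilinear_conv_bounded_bilinear)
  have "Q = (\<lambda>x. polar Q x x)"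
    by (simp add: polar_diagonal[OF assms])
  moreover have "(\<lambda>x. polar Q x x) differentiable (at x within S)" for x
    unfolding differentiable_def by (rule exI, rule FDERIV; rule has_derivative_ident)
  ultimately show ?thesis
    by (auto simp: differentiable_on_def)
qed

section \<open>Even maps of the sphere have even degree\<close>

lemma continuous_map_nsphere_antipodal:
  "continuous_map (nsphere m) (nsphere m) (\<lambda>x i. - x i)"
proof -
  have "continuous_map (powertop_real UNIV) euclideanreal (\<lambda>x. - x k)" for k :: nat
    by (metis UNIV_I continuous_map_product_projection continuous_map_minus)
  then show ?thesis
    by (force simp: nsphere continuous_map_in_subtopology continuous_map_componentwise_UNIV
        intro: continuous_map_from_subtopology)
qed

lemma abs_Brouwer_degree2_antipodal:
  "\<bar>Brouwer_degree2 m (\<lambda>x i. - x i)\<bar> = 1"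
proof (rule Brouwer_degree2_homeomorphic_maps)
  show "homeomorphic_maps (nsphere m) (nsphere m) (\<lambda>x i. - x i) (\<lambda>x i. - x i)"
    using continuous_map_nsphere_antipodal by (auto simp: homeomorphic_maps_def)
qed

lemma hom_induced_restrict_source:
  "hom_induced p Y (topspace Y \<inter> S) Z T g = hom_induced p Y S Z T g"
  using hom_induced_restrict[of p Y "topspace Y \<inter> S" Z T] hom_induced_restrict[of p Y S Z T]
  by (simp add: Int_assoc[symmetric] del: hom_induced_restrict)

lemma hom_induced_restrict_target:
  "hom_induced p Y S Z (topspace Z \<inter> T) g = hom_induced p Y S Z T g"
  using hom_induced_restrict[of p Y S Z "topspace Z \<inter> T"] hom_induced_restrict[of p Y S Z T]
  by (simp add: Int_assoc[symmetric] del: hom_induced_restrict)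

text \<open>
Let \<open>E\<close> be the equator of the sphere \<open>X\<close>, and \<open>L\<close>, \<open>U\<close> its closed hemispheres. In \<open>H\<^sub>n(X, E)\<close> the
fundamental class splits as \<open>a + b\<close> with \<open>a\<close> from \<open>(L, E)\<close> and \<open>b\<close> from \<open>(U, E)\<close>, whose boundaries cancel.
The antipodal map sends \<open>a\<close> to \<open>- \<epsilon> b\<close>, where \<open>\<epsilon> = \<plusminus>1\<close> is its degree on the equator. Since \<open>f\<close> is
invariant under it, the image of the fundamental class in \<open>H\<^sub>n(X, B)\<close> is \<open>(1 - \<epsilon>) f\<^sub>*(b)\<close>, an even
multiple. As \<open>B\<close> is contractible, \<open>H\<^sub>n(X) \<rightarrow> H\<^sub>n(X, B)\<close> is an isomorphism, so the evenness pulls back to the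
degree.
\<close>
lemma even_Brouwer_degree2_even_map:
  assumes cmf: "continuous_map (nsphere (Suc m)) (nsphere (Suc m)) f"
    and even: "\<And>x. x \<in> topspace (nsphere (Suc m)) \<Longrightarrow> f (\<lambda>i. - x i) = f x"
    and fB: "\<And>x. x \<in> topspace (nsphere m) \<Longrightarrow> f x \<in> B"
    and conB: "contractible_space (subtopology (nsphere (Suc m)) B)"
  shows "even (Brouwer_degree2 (Suc m) f)"
proof -
  define n where "n = Suc m"
  define X where "X = nsphere n"
  define E where "E = {x::nat\<Rightarrow>real. x n = 0}"
  define U where "U = subtopology X {x. x n \<ge> 0}"
  define L where "L = subtopology X {x. x n \<le> 0}"
  define neg where "neg = (\<lambda>(x::nat\<Rightarrow>real) i. - x i)"
  define \<epsilon> where "\<epsilon> = Brouwer_degree2 m neg"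
  let ?H = "homology_group n X"
  let ?XE = "relative_homology_group n X E"
  let ?UE = "relative_homology_group n U E"
  let ?LE = "relative_homology_group n L E"
  let ?XB = "relative_homology_group n X B"
  let ?S = "homology_group m (nsphere m)"
  let ?R = "reduced_homology_group m (nsphere m)"
  have equ: "subtopology X E = nsphere m" "subtopology L E = nsphere m" "subtopology U E = nsphere m"
    using subtopology_nsphere_equator[of m]
    by (auto simp: X_def E_def U_def L_def n_def subtopology_subtopology simp flip: Collect_conj_eq
        cong: rev_conj_cong)
  have redH: "reduced_homology_group n X = ?H"
    by (simp add: un_reduced_homology_group n_def)
  have cmX: "continuous_map X X f"
    using cmf by (simp add: X_def n_def)
  have XE: "topspace X \<inter> E = topspace (nsphere m)"
    by (metis equ(1) topspace_subtopology)
  have fE: "f \<in> (topspace X \<inter> E) \<rightarrow> B"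
    using fB XE by auto
  have neg_cm: "continuous_map X X neg"
    using continuous_map_nsphere_antipodal by (simp add: X_def neg_def)
  have neg_LU: "continuous_map L U neg"
    using neg_cm by (auto simp: L_def U_def neg_def continuous_map_in_subtopology
        intro: continuous_map_from_subtopology)
  have neg_E: "neg \<in> E \<rightarrow> E"
    by (auto simp: neg_def E_def)
  have cmU: "continuous_map U X g" and cmL: "continuous_map L X g" if "continuous_map X X g" for g
    using that by (auto simp: U_def L_def continuous_map_from_subtopology)
  have cmid: "continuous_map X X id" by simp
  interpret XE: comm_group ?XE by simp
  interpret XB: comm_group ?XB by simp
  interpret H: group ?H by simp
  interpret R: group ?R by simp
  let ?iL = "hom_induced n L E X E id"
  let ?iU = "hom_induced n U E X E id"
  let ?fXB = "hom_induced n X (topspace X \<inter> E) X B f"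
  let ?FU = "hom_induced n U (topspace X \<inter> E) X B f"
  let ?N = "hom_induced n L E U E neg"
  have topU: "topspace U \<inter> E = topspace X \<inter> E" "topspace L \<inter> E = topspace X \<inter> E"
    by (auto simp: U_def L_def E_def)
  obtain v where v: "v \<in> carrier ?H" and vgen: "subgroup_generated ?H {v} = ?H"
    using cyclic_reduced_homology_group_nsphere[of n n] redH
    by (auto simp: cyclic_group_def X_def)
  have "infinite (carrier ?H)"
    using iso_finite[OF reduced_homology_group_nsphere(1)[of n]] redH by (simp add: X_def)
  then have ordv: "H.ord v = 0"
    using H.infinite_cyclic_subgroup_order[OF v] vgen by metis
  define u where "u = hom_induced n X {} X E id v"
  have ucarr: "u \<in> carrier ?XE"
    by (simp add: u_def hom_induced_carrier)
  \<comment> \<open>The hemispheres split \<open>H\<^sub>n(X, E)\<close> into a direct sum: modulo one hemisphere, excision identifies the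
    homology of the sphere with that of the other.\<close>
  have "(\<lambda>(x, y). ?iL x \<otimes>\<^bsub>?XE\<^esub> ?iU y) \<in> iso (?LE \<times>\<times> ?UE) ?XE \<and>
     (\<lambda>z. (hom_induced n X E X {x. x n \<ge> 0} id z, hom_induced n X E X {x. x n \<le> 0} id z))
      \<in> iso ?XE (relative_homology_group n X {x. x n \<ge> 0} \<times>\<times> relative_homology_group n X {x. x n \<le> 0})"
  proof (rule exact_sequence_sum_lemma)
    show "hom_induced n L E X {x. x n \<ge> 0} id \<in> iso ?LE (relative_homology_group n X {x. x n \<ge> 0})"
      unfolding L_def E_def X_def using iso_relative_homology_group_lower_hemisphere by blast
    show "hom_induced n U E X {x. x n \<le> 0} id \<in> iso ?UE (relative_homology_group n X {x. x n \<le> 0})"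
      unfolding U_def E_def X_def using iso_relative_homology_group_upper_hemisphere by blast
    show "exact_seq ([relative_homology_group n X {x. x n \<le> 0}, ?XE, ?LE],
       [hom_induced n X E X {x. x n \<le> 0} id, ?iL])"
      unfolding L_def E_def by (rule homology_exactness_triple_3) force
    show "exact_seq ([relative_homology_group n X {x. x n \<ge> 0}, ?XE, ?UE],
       [hom_induced n X E X {x. x n \<ge> 0} id, ?iU])"
      unfolding U_def E_def by (rule homology_exactness_triple_3) force
  qed (auto simp: hom_induced_compose' subset_iff L_def U_def E_def)
  then have "carrier ?XE \<subseteq> (\<lambda>(x, y). ?iL x \<otimes>\<^bsub>?XE\<^esub> ?iU y) ` carrier (?LE \<times>\<times> ?UE)"
    by (simp add: iso_iff)
  then obtain a b where a: "a \<in> carrier ?LE" and b: "b \<in> carrier ?UE" and uab: "u = ?iL a \<otimes>\<^bsub>?XE\<^esub> ?iU b"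
    using ucarr by auto
  interpret BX: group_hom ?XE ?S "hom_boundary n X E"
    using hom_boundary_hom[of n X E] by (simp add: group_hom_axioms_def group_hom_def equ n_def)
  \<comment> \<open>The boundary of a hemisphere class may be computed inside the hemisphere, which has the same
    equator as the sphere.\<close>
  have dL: "hom_boundary n X E (?iL a) = hom_boundary n L E a"
  proof -
    have "(hom_boundary n X E \<circ> ?iL) a =
       (hom_induced (int n - 1) (subtopology L E) {} (subtopology X E) {} id \<circ> hom_boundary n L E) a"
      using naturality_hom_induced[OF cmL[OF cmid], of E E n] by simp
    then show ?thesis
      using hom_boundary_carrier[of n L E a] by (simp add: equ hom_induced_id n_def)
  qed
  have dU: "hom_boundary n X E (?iU b) = hom_boundary n U E b"
  proof -
    have "(hom_boundary n X E \<circ> ?iU) b =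
       (hom_induced (int n - 1) (subtopology U E) {} (subtopology X E) {} id \<circ> hom_boundary n U E) b"
      using naturality_hom_induced[OF cmU[OF cmid], of E E n] by simp
    then show ?thesis
      using hom_boundary_carrier[of n U E b] by (simp add: equ hom_induced_id n_def)
  qed
  have "hom_boundary n X E u = \<one>\<^bsub>?S\<^esub>"
  proof -
    have "u \<in> hom_induced n X {} X E id ` carrier ?H"
      using u_def v by blast
    then have "u \<in> kernel ?XE (homology_group (int n - 1) (subtopology X E)) (hom_boundary n X E)"
      using homology_exactness_axiom_1[of n X E] by simp
    then show ?thesis
      by (simp add: kernel_def equ n_def)
  qed
  moreover have "hom_boundary n X E u = hom_boundary n L E a \<otimes>\<^bsub>?S\<^esub> hom_boundary n U E b"
    using a b by (simp add: uab hom_induced_carrier dL dU)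
  ultimately have dsum: "hom_boundary n L E a \<otimes>\<^bsub>?S\<^esub> hom_boundary n U E b = \<one>\<^bsub>?S\<^esub>"
    by simp
  define s where "s = hom_boundary n U E b"
  have isoU: "hom_boundary n U E \<in> iso ?UE ?R"
    using iso_upper_hemisphere_reduced_homology_group[of m m] by (simp add: U_def E_def X_def n_def)
  have isoL: "hom_boundary n L E \<in> iso ?LE ?R"
    using iso_lower_hemisphere_reduced_homology_group[of m m] by (simp add: L_def E_def X_def n_def)
  have s: "s \<in> carrier ?R" and t: "hom_boundary n L E a \<in> carrier ?R"
    using isoU isoL a b by (auto simp: iso_iff s_def)
  have RS: "\<And>x y. x \<otimes>\<^bsub>?R\<^esub> y = x \<otimes>\<^bsub>?S\<^esub> y" "\<one>\<^bsub>?R\<^esub> = \<one>\<^bsub>?S\<^esub>"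
    by (simp_all add: reduced_homology_group_def)
  have ta: "hom_boundary n L E a = inv\<^bsub>?R\<^esub> s"
    using R.inv_equality[of "hom_boundary n L E a" s] dsum s t by (simp add: RS s_def)
  interpret dU: group_hom ?UE ?R "hom_boundary n U E"
    using isoU by (simp add: group_hom_axioms_def group_hom_def iso_iff)
  have Na: "?N a \<in> carrier ?UE"
    by (simp add: hom_induced_carrier)
  have "hom_boundary n U E (?N a) = hom_boundary n U E (b [^]\<^bsub>?UE\<^esub> (- \<epsilon>))"
  proof -
    have "(hom_boundary n U E \<circ> ?N) a =
       (hom_induced (int n - 1) (subtopology L E) {} (subtopology U E) {} neg \<circ> hom_boundary n L E) a"
      using naturality_hom_induced[OF neg_LU neg_E, of n] by simp
    also have "\<dots> = hom_induced m (nsphere m) {} (nsphere m) {} neg (inv\<^bsub>?R\<^esub> s)"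
      using ta by (simp add: equ n_def)
    also have "\<dots> = (inv\<^bsub>?R\<^esub> s) [^]\<^bsub>?R\<^esub> \<epsilon>"
      using Brouwer_degree2[of "inv\<^bsub>?R\<^esub> s" m neg] s by (simp add: \<epsilon>_def)
    also have "\<dots> = s [^]\<^bsub>?R\<^esub> (- \<epsilon>)"
      using s by (simp add: R.int_pow_inv R.int_pow_neg)
    also have "\<dots> = hom_boundary n U E (b [^]\<^bsub>?UE\<^esub> (- \<epsilon>))"
      using b by (simp add: dU.hom_int_pow s_def)
    finally show ?thesis by simp
  qed
  \<comment> \<open>Hemispheres being contractible, their relative classes are determined by their boundaries.\<close>
  then have Na_b: "?N a = b [^]\<^bsub>?UE\<^esub> (- \<epsilon>)"
    using isoU Na b by (auto simp: iso_iff inj_on_def group.int_pow_closed)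
  have FUrest: "?FU = hom_induced n U E X B f"
    by (metis hom_induced_restrict_source topU(1))
  interpret FU: group_hom ?UE ?XB ?FU
    unfolding FUrest by (simp add: group_hom_axioms_def group_hom_def hom_induced_hom)
  interpret FX: group_hom ?XE ?XB ?fXB
    using hom_induced_hom[of n X "topspace X \<inter> E" X B f]
    by (simp add: group_hom_axioms_def group_hom_def)
  have iU': "?iU = hom_induced n U (topspace X \<inter> E) X (topspace X \<inter> E) id"
    by (metis hom_induced_restrict_source hom_induced_restrict_target topU(1))
  have iL': "?iL = hom_induced n L (topspace X \<inter> E) X (topspace X \<inter> E) id"
    by (metis hom_induced_restrict_source hom_induced_restrict_target topU(2))
  have N': "?N = hom_induced n L (topspace X \<inter> E) U (topspace X \<inter> E) neg"
    by (metis hom_induced_restrict_source hom_induced_restrict_target topU)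
  have fU: "?fXB (?iU b) = ?FU b"
    unfolding iU' using fE cmU[OF cmid] cmX by (subst hom_induced_compose') auto
  \<comment> \<open>The only use of evenness: on the lower hemisphere \<open>f\<close> factors through the upper one.\<close>
  have fL: "?fXB (?iL a) = ?FU (?N a)"
  proof -
    have "?fXB (?iL a) = hom_induced n L (topspace X \<inter> E) X B f a"
      unfolding iL' using fE cmL[OF cmid] cmX by (subst hom_induced_compose') auto
    also have "\<dots> = hom_induced n L (topspace X \<inter> E) X B (f \<circ> neg) a"
    proof -
      have "f x = (f \<circ> neg) x" if "x \<in> topspace L" for x
        using even[of x] that by (simp add: L_def X_def n_def neg_def)
      then show ?thesis
        by (metis hom_induced_eq)
    qed
    also have "\<dots> = ?FU (?N a)"
    proof -
      have "neg \<in> topspace X \<inter> E \<rightarrow> topspace X \<inter> E"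
        using neg_cm neg_E by (auto simp: continuous_map_def)
      then show ?thesis
        unfolding N' using neg_LU cmU[OF cmX] fE by (subst hom_induced_compose') auto
    qed
    finally show ?thesis .
  qed
  have "?fXB u = ?FU b [^]\<^bsub>?XB\<^esub> (1 - \<epsilon>)"
  proof -
    have "?fXB u = ?FU (?N a) \<otimes>\<^bsub>?XB\<^esub> ?FU b"
      by (simp add: uab hom_induced_carrier fL fU)
    also have "?FU (?N a) = ?FU b [^]\<^bsub>?XB\<^esub> (- \<epsilon>)"
      using b by (simp add: Na_b FU.hom_int_pow)
    also have "\<dots> \<otimes>\<^bsub>?XB\<^esub> ?FU b = ?FU b [^]\<^bsub>?XB\<^esub> (- \<epsilon> + 1)"
      using b by (subst XB.int_pow_mult) auto
    finally show ?thesis by (simp add: add.commute)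
  qed
  moreover obtain k where k: "1 - \<epsilon> = 2 * k"
  proof -
    have "\<bar>\<epsilon>\<bar> = 1"
      using abs_Brouwer_degree2_antipodal by (simp add: \<epsilon>_def neg_def)
    then show thesis
      using that[of 0] that[of 1] by linarith
  qed
  let ?j = "hom_induced n X {} X B id"
  have jiso: "?j \<in> iso ?H ?XB"
  proof -
    have "(\<lambda>i. if i = 0 then 1 else 0) \<in> topspace (nsphere m)"
      by (rule in_topspace_nsphere)
    then have "f (\<lambda>i. if i = 0 then 1 else 0) \<in> topspace X \<inter> B"
      using XE fB cmX by (auto simp: continuous_map_def)
    then show ?thesis
      using iso_reduced_homology_by_contractible[of X B n] conB
      by (metis X_def n_def empty_iff redH)
  qed
  then have "?FU b \<in> ?j ` carrier ?H"
    using FU.hom_closed[OF b] unfolding iso_iff by blast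
  then obtain w where w: "w \<in> carrier ?H" "?FU b = ?j w"
    by blast
  obtain i :: int where i: "w = v [^]\<^bsub>?H\<^esub> i"
    using w(1) v vgen H.carrier_subgroup_generated_by_singleton[OF v] by auto
  interpret j: group_hom ?H ?XB ?j
    using jiso by (simp add: group_hom_axioms_def group_hom_def iso_iff)
  have "?fXB u = ?j (v [^]\<^bsub>?H\<^esub> Brouwer_degree2 n f)"
  proof -
    have "u = hom_induced n X {} X (topspace X \<inter> E) id v"
      by (simp add: u_def hom_induced_restrict_target)
    then have "?fXB u = hom_induced n X {} X B f v"
      using cmX fE by (simp add: hom_induced_compose')
    also have "\<dots> = ?j (hom_induced n X {} X {} f v)"
      using cmX by (simp add: hom_induced_compose')
    also have "hom_induced n X {} X {} f v = v [^]\<^bsub>?H\<^esub> Brouwer_degree2 n f"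
      using Brouwer_degree2[of v n f] v redH by (simp add: X_def)
    finally show ?thesis .
  qed
  moreover have "?FU b [^]\<^bsub>?XB\<^esub> (1 - \<epsilon>) = ?j (v [^]\<^bsub>?H\<^esub> (i * (2 * k)))"
    using v w by (simp add: i k j.hom_int_pow XB.int_pow_pow)
  ultimately have "?j (v [^]\<^bsub>?H\<^esub> Brouwer_degree2 n f) = ?j (v [^]\<^bsub>?H\<^esub> (i * (2 * k)))"
    by simp
  then have "v [^]\<^bsub>?H\<^esub> Brouwer_degree2 n f = v [^]\<^bsub>?H\<^esub> (i * (2 * k))"
    using jiso v by (auto simp: iso_iff inj_on_def)
  then have "Brouwer_degree2 n f = i * (2 * k)"
    using v ordv by (simp add: H.int_pow_eq)
  then show ?thesis
    by (simp add: n_def)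
qed

section \<open>Invariant rays\<close>

text \<open>
The segment from \<open>q x\<close> to \<open>- x\<close> meets the origin only if \<open>q x = x\<close>, so the straight-line homotopy can be
projected radially to the sphere.
\<close>
lemma homotopic_antipodal_if_no_fixed_point:
  fixes q :: "'a::euclidean_space \<Rightarrow> 'a"
  assumes q: "continuous_on (sphere 0 1) q" "q \<in> sphere 0 1 \<rightarrow> sphere 0 1"
    and nofix: "\<And>x. x \<in> sphere 0 1 \<Longrightarrow> q x \<noteq> x"
  shows "homotopic_with_canon (\<lambda>_. True) (sphere 0 1) (sphere 0 1) q uminus"
proof -
  have nq: "norm (q x) = 1" if "norm x = 1" for x
    using q(2) that by auto
  have "homotopic_with_canon (\<lambda>_. True) (sphere 0 1) (- {0}) q uminus"
  proof (rule homotopic_with_linear)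
    fix x :: 'a
    assume x: "x \<in> sphere 0 1"
    have False if u: "0 \<le> u" "u \<le> 1" and eq: "(1 - u) *\<^sub>R q x + u *\<^sub>R (- x) = 0" for u
    proof -
      have qx: "norm (q x) = 1"
        using q(2) x by auto
      have eq': "(1 - u) *\<^sub>R q x = u *\<^sub>R x"
        using eq by simp
      then have "norm ((1 - u) *\<^sub>R q x) = norm (u *\<^sub>R x)"
        by simp
      then have u2: "1 - u = u"
        using u qx x by simp
      then have "u *\<^sub>R q x = u *\<^sub>R x"
        using eq' by metis
      then show False
        using nofix[OF x] u2 by auto
    qed
    then show "closed_segment (q x) (- x) \<subseteq> - {0}"
      by (force simp: closed_segment_def)
  qed (use q in \<open>auto intro!: continuous_intros\<close>)
  moreover have "continuous_map (top_of_set (- {0})) (top_of_set (sphere 0 1)) (\<lambda>x::'a. x /\<^sub>R norm x)"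
    by (auto intro!: continuous_intros)
  ultimately have "homotopic_with_canon (\<lambda>_. True) (sphere 0 1) (sphere 0 1)
     ((\<lambda>x. x /\<^sub>R norm x) \<circ> q) ((\<lambda>x. x /\<^sub>R norm x) \<circ> uminus)"
    by (rule homotopic_with_compose_continuous_map_left) auto
  then show ?thesis
    by (rule homotopic_with_eq) (use nq in simp_all)
qed

lemma contractible_punctured_sphere:
  fixes w :: "'a::euclidean_space"
  assumes "w \<in> sphere 0 1"
  shows "contractible (sphere 0 1 - {w})"
proof -
  have "w \<noteq> 0"
    using assms by auto
  then have "(sphere 0 1 - {w}) homeomorphic {x. w \<bullet> x = 0}"
    using assms by (intro homeomorphic_punctured_sphere_hyperplane) auto
  moreover have "contractible {x. w \<bullet> x = 0}"
    by (intro convex_imp_contractible convex_hyperplane)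
  ultimately show ?thesis
    using homeomorphic_contractible_eq by blast
qed

text \<open>
Degrees are available for the model sphere of real sequences, quadratic maps live on a Euclidean
space. The identification of the two is linear, hence commutes with the antipodal maps, and the model
equator, where the last coordinate vanishes, corresponds to the hyperplane orthogonal to \<open>c\<close>.
\<close>
lemma nsphere_coordinates:
  assumes "DIM('a::euclidean_space) = Suc p"
  obtains F :: "(nat \<Rightarrow> real) \<Rightarrow> 'a::euclidean_space" and G c where
    "homeomorphic_maps (nsphere p) (top_of_set (sphere 0 1)) F G"
    "\<And>x. F (\<lambda>i. - x i) = - F x" "\<And>v. G (- v) = (\<lambda>i. - G v i)"
    "\<And>x. c \<bullet> F x = x p" "c \<noteq> 0"
proof -
  obtain b where "bij_betw b {0..<DIM('a)} (Basis :: 'a::euclidean_space set)"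
    using ex_bij_betw_nat_finite[OF finite_Basis] by blast
  then have b: "bij_betw b {..p} (Basis :: 'a::euclidean_space set)"
    by (simp add: assms atLeast0LessThan lessThan_Suc_atMost)
  have bB: "b i \<in> Basis" if "i \<le> p" for i
    using b that by (auto simp: bij_betw_def)
  have bb: "b i \<bullet> b j = (if i = j then 1 else 0)" if "i \<le> p" "j \<le> p" for i j
    using b that inj_on_eq_iff[of b "{..p}" i j] by (simp add: inner_Basis bB bij_betw_def)
  define F where "F = (\<lambda>x::nat\<Rightarrow>real. \<Sum>i\<le>p. x i *\<^sub>R b i)"
  define G where "G = (\<lambda>v i. if i \<le> p then v \<bullet> b i else 0)"
  have Fb: "F x \<bullet> b j = x j" if "j \<le> p" for x j
  proof -
    have "F x \<bullet> b j = (\<Sum>i\<le>p. if i = j then x i else 0)"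
      unfolding F_def inner_sum_left using that by (intro sum.cong) (auto simp: bb)
    then show ?thesis
      using that by simp
  qed
  have FG: "F (G v) = v" for v
  proof -
    have "F (G v) = (\<Sum>i\<le>p. (v \<bullet> b i) *\<^sub>R b i)"
      by (simp add: F_def G_def)
    also have "\<dots> = (\<Sum>i\<in>Basis. (v \<bullet> i) *\<^sub>R i)"
      by (rule sum.reindex_bij_betw[OF b])
    finally show ?thesis
      by (simp add: euclidean_representation)
  qed
  have normF: "(norm (F x))\<^sup>2 = (\<Sum>i\<le>p. (x i)\<^sup>2)" for x
  proof -
    have "(norm (F x))\<^sup>2 = F x \<bullet> (\<Sum>i\<le>p. x i *\<^sub>R b i)"
      unfolding power2_norm_eq_inner F_def by (rule refl)
    also have "\<dots> = (\<Sum>i\<le>p. (x i)\<^sup>2)"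
      unfolding inner_sum_right by (intro sum.cong) (auto simp: Fb power2_eq_square)
    finally show ?thesis .
  qed
  have GF: "G (F x) = x" if "x \<in> topspace (nsphere p)" for x
    using that by (auto simp: nsphere G_def Fb fun_eq_iff)
  have "continuous_map (nsphere p) euclidean F"
    unfolding F_def
  proof (intro continuous_map_sum)
    fix i
    have "continuous_map euclideanreal euclidean (\<lambda>r. r *\<^sub>R b i)"
      by (auto intro!: continuous_intros)
    then show "continuous_map (nsphere p) euclidean (\<lambda>x. x i *\<^sub>R b i)"
      using continuous_map_compose[OF continuous_map_nsphere_projection, of euclidean] by (simp add: o_def)
  qed auto
  moreover have "norm (F x) = 1" if "x \<in> topspace (nsphere p)" for x
  proof -
    have "(norm (F x))\<^sup>2 = 1\<^sup>2"
      using normF[of x] that by (simp add: nsphere)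
    then show ?thesis
      by (rule power2_eq_imp_eq) auto
  qed
  ultimately have cmF: "continuous_map (nsphere p) (top_of_set (sphere 0 1)) F"
    unfolding continuous_map_in_subtopology by (simp add: image_subset_iff Pi_iff)
  have "continuous_on (sphere 0 1) (\<lambda>v. G v i)" for i
    by (cases "i \<le> p") (auto simp: G_def intro!: continuous_intros)
  then have cmG: "continuous_map (top_of_set (sphere 0 1)) (powertop_real UNIV) G"
    unfolding continuous_map_componentwise_UNIV by simp
  have Gs: "(\<Sum>i\<le>p. (G v i)\<^sup>2) = 1 \<and> (\<forall>i>p. G v i = 0)" if "v \<in> sphere 0 1" for v
  proof -
    have "(\<Sum>i\<le>p. (G v i)\<^sup>2) = 1"
      using normF[of "G v"] that by (simp add: FG)
    then show ?thesis
      by (simp add: G_def)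
  qed
  have cmG: "continuous_map (top_of_set (sphere 0 1)) (nsphere p) G"
    unfolding nsphere using Gs by (intro continuous_map_into_subtopology cmG) simp
  show thesis
  proof
    show "homeomorphic_maps (nsphere p) (top_of_set (sphere 0 1)) F G"
      unfolding homeomorphic_maps_def using GF FG by (intro conjI cmF cmG) blast+
    show "F (\<lambda>i. - x i) = - F x" for x
      by (simp add: F_def sum_negf)
    show "G (- v) = (\<lambda>i. - G v i)" for v
      by (auto simp: G_def)
    show "b p \<bullet> F x = x p" for x
      using Fb[of p x] by (simp add: inner_commute)
    show "b p \<noteq> 0"
      by (rule nonzero_Basis[OF bB]) simp
  qed
qed

text \<open>
The hypothesis \<open>nonsurj\<close> holds for smooth \<open>q\<close>. It lets the punctured sphere serve as the contractible set
that contains the image of the equator. The equator degenerates in dimension 1, where the sphere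
has only two points.
\<close>
lemma even_sphere_map_has_fixed_point:
  fixes q :: "'a::euclidean_space \<Rightarrow> 'a"
  assumes q: "continuous_on (sphere 0 1) q" "q \<in> sphere 0 1 \<rightarrow> sphere 0 1"
    and even: "\<And>x. x \<in> sphere 0 1 \<Longrightarrow> q (- x) = q x"
    and nonsurj: "\<And>c::'a. c \<noteq> 0 \<Longrightarrow> \<exists>w \<in> sphere 0 1. \<forall>x \<in> sphere 0 1. c \<bullet> x = 0 \<longrightarrow> q x \<noteq> w"
    and dim: "DIM('a) \<ge> 2"
  shows "\<exists>x \<in> sphere 0 1. q x = x"
proof (rule ccontr)
  assume "\<not> (\<exists>x \<in> sphere 0 1. q x = x)"
  then have nofix: "\<And>x. x \<in> sphere 0 1 \<Longrightarrow> q x \<noteq> x"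
    by blast
  obtain m where m: "DIM('a) = Suc (Suc m)"
    using dim that[of "DIM('a) - 2"] by simp
  obtain F :: "(nat \<Rightarrow> real) \<Rightarrow> 'a::euclidean_space" and G c where
    FG: "homeomorphic_maps (nsphere (Suc m)) (top_of_set (sphere 0 1)) F G"
    and Fneg: "\<And>x. F (\<lambda>i. - x i) = - F x" and Gneg: "\<And>v. G (- v) = (\<lambda>i. - G v i)"
    and c: "\<And>x. c \<bullet> F x = x (Suc m)" "c \<noteq> 0"
    by (rule nsphere_coordinates[OF m]) (rule that; assumption)
  have cmF: "continuous_map (nsphere (Suc m)) (top_of_set (sphere 0 1)) F"
    and cmG: "continuous_map (top_of_set (sphere 0 1)) (nsphere (Suc m)) G"
    and GF: "\<And>x. x \<in> topspace (nsphere (Suc m)) \<Longrightarrow> G (F x) = x"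
    and FG': "\<And>v. v \<in> sphere 0 1 \<Longrightarrow> F (G v) = v"
    using FG unfolding homeomorphic_maps_def by simp_all
  have Fs: "F x \<in> sphere 0 1" if "x \<in> topspace (nsphere (Suc m))" for x
    using continuous_map_image_subset_topspace[OF cmF] that by auto
  obtain w where w: "w \<in> sphere 0 1" "\<And>x. x \<in> sphere 0 1 \<Longrightarrow> c \<bullet> x = 0 \<Longrightarrow> q x \<noteq> w"
    using nonsurj[OF c(2)] by blast
  define f where "f = G \<circ> (q \<circ> F)"
  have cmq: "continuous_map (top_of_set (sphere 0 1)) (top_of_set (sphere 0 1)) q"
    using q by auto
  have "homotopic_with (\<lambda>_. True) (nsphere (Suc m)) (nsphere (Suc m)) f (G \<circ> (uminus \<circ> F))"
    unfolding f_def
    using homotopic_antipodal_if_no_fixed_point[OF q nofix] cmF cmG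
    by (intro homotopic_with_compose_continuous_map_left[OF homotopic_with_compose_continuous_map_right]) auto
  then have "homotopic_with (\<lambda>_. True) (nsphere (Suc m)) (nsphere (Suc m)) f (\<lambda>x i. - x i)"
    by (rule homotopic_with_eq) (auto simp: Gneg GF)
  then have "\<bar>Brouwer_degree2 (Suc m) f\<bar> = 1"
    using Brouwer_degree2_homotopic abs_Brouwer_degree2_antipodal by metis
  moreover have "even (Brouwer_degree2 (Suc m) f)"
  proof (rule even_Brouwer_degree2_even_map)
    show "continuous_map (nsphere (Suc m)) (nsphere (Suc m)) f"
      unfolding f_def using cmF cmG cmq by (blast intro: continuous_map_compose)
    show "f (\<lambda>i. - x i) = f x" if "x \<in> topspace (nsphere (Suc m))" for x
      using Fs[OF that] by (simp add: f_def Fneg even)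
    have "homeomorphic_maps (subtopology (nsphere (Suc m)) {x. F x \<noteq> w})
        (subtopology (top_of_set (sphere 0 1)) (- {w})) F G"
      by (rule homeomorphic_maps_subtopologies_alt[OF FG]) (auto simp: FG')
    then have "subtopology (nsphere (Suc m)) {x. F x \<noteq> w} homeomorphic_space top_of_set (sphere 0 1 - {w})"
      by (auto simp: homeomorphic_space_def subtopology_subtopology Diff_eq)
    then show "contractible_space (subtopology (nsphere (Suc m)) {x. F x \<noteq> w})"
      using contractible_punctured_sphere[OF w(1)] homeomorphic_space_contractibility
        contractible_space_top_of_set by metis
    fix x :: "nat \<Rightarrow> real"
    assume "x \<in> topspace (nsphere m)"
    then have "x \<in> topspace (nsphere (Suc m))" "x (Suc m) = 0"
      by (auto simp: nsphere)
    then show "f x \<in> {x. F x \<noteq> w}"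
      using Fs[of x] w(2)[of "F x"] c(1)[of x] q(2) by (auto simp: f_def FG' Pi_iff)
  qed
  ultimately show False
    by (metis abs_1 dvd_abs_iff odd_one)
qed

text \<open>
A fixed point of the normalized map \<open>x \<mapsto> Q x / |Q x|\<close> spans an invariant ray. In dimension 1 every
direction is invariant, and replacing \<open>b\<close> by \<open>- b\<close> flips the sign of the eigenvalue.
\<close>
lemma quadratic_ray:
  fixes Q :: "'a::euclidean_space \<Rightarrow> 'a"
  assumes Q: "Q \<in> quadratic_maps" and nz: "\<And>x. x \<noteq> 0 \<Longrightarrow> Q x \<noteq> 0"
  obtains A l where "A \<noteq> 0" "l > 0" "Q A = l *\<^sub>R A"
proof (cases "DIM('a) = 1")
  case True
  then obtain b where b: "(Basis :: 'a set) = {b}"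
    by (auto simp: card_1_singleton_iff)
  have "b \<noteq> 0"
    using b nonzero_Basis[of b] by auto
  have Qb: "Q b = (Q b \<bullet> b) *\<^sub>R b"
    using euclidean_representation[of "Q b"] by (simp add: b)
  with nz[OF \<open>b \<noteq> 0\<close>] have "Q b \<bullet> b \<noteq> 0"
    by auto
  then consider "Q b \<bullet> b > 0" | "- (Q b \<bullet> b) > 0"
    by linarith
  then show thesis
  proof cases
    case 1
    then show thesis using that[of b "Q b \<bullet> b"] \<open>b \<noteq> 0\<close> Qb by simp
  next
    case 2
    have "Q (- b) = (- (Q b \<bullet> b)) *\<^sub>R (- b)"
      using Qb by (simp add: quadratic_minus[OF Q])
    then show thesis using that[of "- b" "- (Q b \<bullet> b)"] \<open>b \<noteq> 0\<close> 2 by simp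
  qed
next
  case False
  define q where "q = (\<lambda>x. Q x /\<^sub>R norm (Q x))"
  have "\<exists>x \<in> sphere 0 1. q x = x"
  proof (rule even_sphere_map_has_fixed_point)
    have nzs: "Q x \<noteq> 0" if "norm x = 1" for x
      using nz that by (metis norm_zero zero_neq_one)
    have "continuous_on (sphere 0 1) Q"
      by (intro differentiable_imp_continuous_on quadratic_differentiable Q)
    then show "continuous_on (sphere 0 1) q"
      unfolding q_def by (intro continuous_intros) (auto simp: nzs)
    show "q \<in> sphere 0 1 \<rightarrow> sphere 0 1"
      by (auto simp: q_def nzs)
    show "q (- x) = q x" for x
      by (simp add: q_def quadratic_minus[OF Q])
    show "DIM('a) \<ge> 2"
      using False DIM_positive[where 'a = 'a] by linarith
    fix c :: 'a
    assume "c \<noteq> 0"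
    then have "negligible {x. c \<bullet> x = 0}"
      by (intro negligible_hyperplane) auto
    then have "negligible (insert 0 (Q ` {x. c \<bullet> x = 0}))"
      using negligible_differentiable_image_negligible[OF order_refl _ quadratic_differentiable[OF Q]]
      by (simp add: negligible_insert)
    \<comment> \<open>The image of the hyperplane is a cone, so the direction of a vector outside it is missed by \<open>q\<close>
      on the equator.\<close>
    then have "insert 0 (Q ` {x. c \<bullet> x = 0}) \<noteq> UNIV"
      using non_negligible_UNIV by metis
    then obtain w where w: "w \<noteq> 0" "\<And>x. c \<bullet> x = 0 \<Longrightarrow> Q x \<noteq> w"
      by blast
    have "q x \<noteq> w /\<^sub>R norm w" if x: "norm x = 1" "c \<bullet> x = 0" for x
    proof
      assume eq: "q x = w /\<^sub>R norm w"
      define r where "r = sqrt (norm w / norm (Q x))"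
      have "r\<^sup>2 = norm w / norm (Q x)"
        by (simp add: r_def)
      then have "Q (r *\<^sub>R x) = norm w *\<^sub>R q x"
        by (simp add: quadratic_scaleR[OF Q] q_def divide_inverse)
      then have "Q (r *\<^sub>R x) = w"
        using w(1) by (simp add: eq)
      then show False
        using w(2)[of "r *\<^sub>R x"] x by simp
    qed
    then show "\<exists>w \<in> sphere 0 1. \<forall>x \<in> sphere 0 1. c \<bullet> x = 0 \<longrightarrow> q x \<noteq> w"
      using w(1) by (intro bexI[of _ "w /\<^sub>R norm w"]) auto
  qed
  then obtain x where x: "norm x = 1" "q x = x"
    by auto
  then have "x \<noteq> 0"
    by auto
  then have "norm (Q x) > 0"
    using nz by simp
  moreover have "Q x = norm (Q x) *\<^sub>R x"
  proof -
    have "Q x = norm (Q x) *\<^sub>R q x"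
      using \<open>norm (Q x) > 0\<close> by (simp add: q_def)
    then show ?thesis by (simp add: x)
  qed
  ultimately show thesis
    using that \<open>x \<noteq> 0\<close> by blast
qed

lemma blows_up_along_ray:
  fixes Q :: "'a::euclidean_space \<Rightarrow> 'a"
  assumes Q: "Q \<in> quadratic_maps" and A: "A \<noteq> 0" "l > 0" "Q A = l *\<^sub>R A"
  shows "blows_up_in_finite_time Q A"
proof -
  define X where "X = (\<lambda>t. (1 / (1 - l * t)) *\<^sub>R A)"
  have "(X has_vector_derivative Q (X t)) (at t within {0..<1/l})" if "t \<in> {0..<1/l}" for t
  proof -
    have ne: "1 - l * t \<noteq> 0"
      using that A by (auto simp: field_simps)
    have "((\<lambda>t. 1 / (1 - l * t)) has_real_derivative l / (1 - l * t)\<^sup>2) (at t within {0..<1/l})"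
      using ne by (auto intro!: derivative_eq_intros simp: power2_eq_square)
    then have "(X has_vector_derivative (l / (1 - l * t)\<^sup>2) *\<^sub>R A) (at t within {0..<1/l})"
      unfolding X_def has_real_derivative_iff_has_vector_derivative
      by (rule bounded_linear.has_vector_derivative[OF bounded_linear_scaleR_left])
    moreover have "Q (X t) = (l / (1 - l * t)\<^sup>2) *\<^sub>R A"
      by (simp add: X_def quadratic_scaleR[OF Q] A power_divide)
    ultimately show ?thesis
      by simp
  qed
  moreover have "filterlim (\<lambda>t. norm (X t)) at_top (at_left (1/l))"
  proof -
    have below: "\<forall>\<^sub>F t in at_left (1/l). t < 1/l"
      by (simp add: eventually_at_left_field) (meson lt_ex)
    have "((\<lambda>t. 1 - l * t) \<longlongrightarrow> 1 - l * (1/l)) (at_left (1/l))"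
      by (intro tendsto_intros)
    then have "filterlim (\<lambda>t. 1 - l * t) (at_right 0) (at_left (1/l))"
      using A below by (auto simp: filterlim_at field_simps elim!: eventually_mono)
    then have "filterlim (\<lambda>t. norm A * inverse (1 - l * t)) at_top (at_left (1/l))"
      using A by (intro filterlim_tendsto_pos_mult_at_top[OF tendsto_const]
          filterlim_compose[OF filterlim_inverse_at_top_right]) auto
    moreover have "\<forall>\<^sub>F t in at_left (1/l). norm A * inverse (1 - l * t) = norm (X t)"
      using below by eventually_elim (use A in \<open>auto simp: X_def field_simps\<close>)
    ultimately show ?thesis
      by (rule filterlim_cong[THEN iffD1, rotated 3, OF _ refl refl])
  qed
  ultimately show ?thesis
    unfolding blows_up_in_finite_time_def using A
    by (intro exI[of _ "1/l"] conjI exI[of _ X]) (auto simp: X_def)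
qed

section \<open>Polynomials on the space of quadratic maps\<close>

lemma bilinear_from_basis:
  fixes D :: "'a::euclidean_space \<Rightarrow> 'a \<Rightarrow> 'a"
  assumes sym: "\<And>u v. u \<in> Basis \<Longrightarrow> v \<in> Basis \<Longrightarrow> D u v = D v u"
  obtains B where "bilinear B" "\<And>x y. B x y = B y x"
    "\<And>u v. u \<in> Basis \<Longrightarrow> v \<in> Basis \<Longrightarrow> B u v = D u v"
proof
  let ?B = "\<lambda>x y. \<Sum>u\<in>Basis. \<Sum>v\<in>Basis. ((x \<bullet> u) * (y \<bullet> v)) *\<^sub>R D u v"
  show "bilinear ?B"
    by (auto simp: bilinear_def linear_iff inner_add_left algebra_simps sum.distrib scaleR_sum_right
        scaleR_add_left)
  show "?B x y = ?B y x" for x y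
    by (subst sum.swap) (auto intro!: sum.cong simp: sym mult.commute)
  show "?B u v = D u v" if "u \<in> Basis" "v \<in> Basis" for u v
  proof -
    have "?B u v = (\<Sum>u'\<in>Basis. \<Sum>v'\<in>Basis. if u' = u then (if v' = v then D u' v' else 0) else 0)"
      using that by (intro sum.cong refl) (auto simp: inner_Basis)
    also have "\<dots> = (\<Sum>u'\<in>Basis. if u' = u then (\<Sum>v'\<in>Basis. if v' = v then D u' v' else 0) else 0)"
      by (intro sum.cong refl) auto
    also have "\<dots> = D u v"
      using that by simp
    finally show ?thesis .
  qed
qed

text \<open>
The coordinates are the entries \<open>polar Q u v \<bullet> w\<close> of the polar form at basis vectors. By symmetry
the pairs \<open>(u, v)\<close> and \<open>(v, u)\<close> give the same entry, so only the pairs ordered by an arbitrary numbering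
\<open>ind\<close> of the basis are kept; without this the coordinates would be redundant.
\<close>
lemma quadratic_maps_coordinates:
  obtains N \<phi> where
    "linear_coordinates N (\<phi> :: nat \<Rightarrow> ('a::euclidean_space \<Rightarrow> 'a) \<Rightarrow> real)"
    "\<And>u v w. u \<in> Basis \<Longrightarrow> v \<in> Basis \<Longrightarrow> w \<in> Basis \<Longrightarrow>
       \<exists>i<N. \<forall>Q\<in>quadratic_maps. polar Q u v \<bullet> w = \<phi> i Q"
proof -
  obtain ind :: "'a \<Rightarrow> nat" where ind: "inj_on ind Basis"
    using finite_imp_inj_to_nat_seg[OF finite_Basis] by blast
  define I where "I = {(u::'a, v::'a, w::'a). u \<in> Basis \<and> v \<in> Basis \<and> w \<in> Basis \<and> ind u \<le> ind v}"
  have "finite I"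
    by (rule finite_subset[of _ "Basis \<times> Basis \<times> Basis"]) (auto simp: I_def)
  then obtain h where h: "bij_betw h {0..<card I} I"
    using ex_bij_betw_nat_finite by blast
  define \<phi> where "\<phi> = (\<lambda>i Q. case h i of (u, v, w) \<Rightarrow> polar Q u v \<bullet> (w::'a))"
  have coord: "\<exists>i<card I. h i = (u, v, w)" if "(u, v, w) \<in> I" for u v w
    using h that by (auto simp: bij_betw_def image_iff set_eq_iff) (metis atLeastLessThan_iff)
  have coord2: "\<exists>i<card I. \<forall>Q\<in>quadratic_maps. polar Q u v \<bullet> w = \<phi> i Q"
    if uvw: "u \<in> Basis" "v \<in> Basis" "w \<in> Basis" for u v w
  proof (cases "ind u \<le> ind v")
    case True
    then obtain i where "i < card I" "h i = (u, v, w)"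
      using coord[of u v w] uvw by (auto simp: I_def)
    then show ?thesis
      by (intro exI[of _ i]) (auto simp: \<phi>_def)
  next
    case False
    then obtain i where "i < card I" "h i = (v, u, w)"
      using coord[of v u w] uvw by (auto simp: I_def)
    then show ?thesis
      by (intro exI[of _ i]) (auto simp: \<phi>_def polar_commute[of _ u v])
  qed
  have "linear_coordinates (card I) \<phi>"
    unfolding linear_coordinates_def
  proof (intro conjI allI impI)
    fix i
    show "linear_functional (\<phi> i)"
      by (cases "h i") (auto simp: linear_functional_def \<phi>_def polar_def algebra_simps
          inner_add_left inner_diff_left add_divide_distrib diff_divide_distrib)
  next
    fix c :: "nat \<Rightarrow> real"
    define k where "k = (\<lambda>t. c (the_inv_into {0..<card I} h t))"
    have kh: "k (h i) = c i" if "i < card I" for i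
      using h that by (simp add: k_def the_inv_into_f_f bij_betw_def)
    define C where "C = (\<lambda>u v w. if ind u \<le> ind v then k (u, v, w) else k (v, u, w))"
    define D where "D = (\<lambda>u v. \<Sum>w\<in>Basis. C u v w *\<^sub>R (w::'a))"
    have "C u v w = C v u w" if "u \<in> Basis" "v \<in> Basis" for u v w
      using inj_onD[OF ind _ that] by (auto simp: C_def)
    then have "D u v = D v u" if "u \<in> Basis" "v \<in> Basis" for u v
      using that by (simp add: D_def)
    then obtain B where B: "bilinear B" "\<And>x y. B x y = B y x"
      "\<And>u v. u \<in> Basis \<Longrightarrow> v \<in> Basis \<Longrightarrow> B u v = D u v"
      using bilinear_from_basis by blast
    define Q where "Q = (\<lambda>x. B x x)"
    have Q: "Q \<in> quadratic_maps"
      using B by (auto simp: Q_def intro: quadratic_mapI)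
    have pQ: "polar Q = B"
      by (intro ext polar_eq B) (simp add: Q_def)
    have \<phi>Q: "\<phi> i Q = c i" if i: "i < card I" for i
    proof -
      obtain u v w where hi: "h i = (u, v, w)"
        by (cases "h i") auto
      have "h i \<in> I"
        using bij_betwE[OF h] i by simp
      then have uvw: "u \<in> Basis" "v \<in> Basis" "w \<in> Basis" "ind u \<le> ind v"
        by (simp_all add: hi I_def)
      have "\<phi> i Q = D u v \<bullet> w"
        using uvw by (simp add: \<phi>_def hi pQ B)
      also have "\<dots> = C u v w"
        using uvw by (simp add: D_def inner_sum_left_Basis)
      also have "\<dots> = c i"
        using uvw kh[OF i] by (simp add: C_def hi)
      finally show ?thesis .
    qed
    show "\<exists>!Q. Q \<in> quadratic_maps \<and> (\<forall>i<card I. \<phi> i Q = c i)"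
    proof (rule ex1I[of _ Q])
      show "Q \<in> quadratic_maps \<and> (\<forall>i<card I. \<phi> i Q = c i)"
        using Q \<phi>Q by blast
      fix P
      assume P: "P \<in> quadratic_maps \<and> (\<forall>i<card I. \<phi> i P = c i)"
      have "polar P = polar Q"
      proof (rule bilinear_eq_stdbasis)
        show "bilinear (polar P)" "bilinear (polar Q)"
          using P Q by (auto intro: bilinear_polar)
        fix u v :: 'a
        assume uv: "u \<in> Basis" "v \<in> Basis"
        show "polar P u v = polar Q u v"
        proof (rule euclidean_eqI)
          fix w :: 'a
          assume "w \<in> Basis"
          then obtain i where "i < card I" "\<forall>Q\<in>quadratic_maps. polar Q u v \<bullet> w = \<phi> i Q"
            using coord2[OF uv] by blast
          then show "polar P u v \<bullet> w = polar Q u v \<bullet> w"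
            using P Q \<phi>Q by auto
        qed
      qed
      then show "P = Q"
        using P Q polar_diagonal by (metis ext)
    qed
  qed
  with coord2 show thesis
    using that by blast
qed

text \<open>
Fixing the coordinates \<open>\<phi>\<close> makes sums and products of polynomials meaningful without a change of
coordinates.
\<close>
definition polynomial_in ::
  "nat \<Rightarrow> (nat \<Rightarrow> ('a::real_vector \<Rightarrow> 'a) \<Rightarrow> real) \<Rightarrow> (('a \<Rightarrow> 'a) \<Rightarrow> real) \<Rightarrow> bool" where
  "polynomial_in N \<phi> f \<longleftrightarrow>
     (\<exists>(M :: (nat \<Rightarrow> nat) set) (a :: (nat \<Rightarrow> nat) \<Rightarrow> real). finite M \<and>
       (\<forall>Q\<in>quadratic_maps. f Q = (\<Sum>m\<in>M. a m * (\<Prod>i<N. \<phi> i Q ^ m i))))"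

text \<open>
Allowing an arbitrary index set in which exponent vectors may repeat spares collecting like terms in each
closure property below.
\<close>
lemma polynomial_inI:
  fixes f :: "('a::real_vector \<Rightarrow> 'a) \<Rightarrow> real"
  assumes T: "finite T"
    and f: "\<And>Q. Q \<in> quadratic_maps \<Longrightarrow> f Q = (\<Sum>t\<in>T. a t * (\<Prod>i<N. \<phi> i Q ^ e t i))"
  shows "polynomial_in N \<phi> f"
  unfolding polynomial_in_def
proof (intro exI conjI ballI)
  show "finite (e ` T)"
    using T by simp
  fix Q :: "'a \<Rightarrow> 'a"
  assume Q: "Q \<in> quadratic_maps"
  have "f Q = (\<Sum>m\<in>e ` T. \<Sum>t\<in>{t\<in>T. e t = m}. a t * (\<Prod>i<N. \<phi> i Q ^ e t i))"
    unfolding f[OF Q] by (rule sum.image_gen[OF T])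
  also have "\<dots> = (\<Sum>m\<in>e ` T. (\<Sum>t\<in>{t\<in>T. e t = m}. a t) * (\<Prod>i<N. \<phi> i Q ^ m i))"
    by (intro sum.cong refl) (simp add: sum_distrib_right)
  finally show "f Q = (\<Sum>m\<in>e ` T. (\<Sum>t\<in>{t\<in>T. e t = m}. a t) * (\<Prod>i<N. \<phi> i Q ^ m i))" .
qed

lemma polynomial_in_const: "polynomial_in N \<phi> (\<lambda>Q. c)"
  by (rule polynomial_inI[where T = "{()}" and a = "\<lambda>_. c" and e = "\<lambda>_ _. 0"]) auto

lemma polynomial_in_coordinate:
  fixes f :: "('a::real_vector \<Rightarrow> 'a) \<Rightarrow> real"
  assumes "j < N" "\<And>Q. Q \<in> quadratic_maps \<Longrightarrow> f Q = \<phi> j Q"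
  shows "polynomial_in N \<phi> f"
proof (rule polynomial_inI[where T = "{()}" and a = "\<lambda>_. 1" and e = "\<lambda>_ i. if i = j then 1 else 0"])
  fix Q :: "'a \<Rightarrow> 'a"
  assume "Q \<in> quadratic_maps"
  have "(\<Prod>i<N. \<phi> i Q ^ (if i = j then 1 else 0)) = (\<Prod>i<N. if i = j then \<phi> i Q else 1)"
    by (intro prod.cong) auto
  then show "f Q = (\<Sum>t\<in>{()}. 1 * (\<Prod>i<N. \<phi> i Q ^ (if i = j then 1 else 0)))"
    using assms \<open>Q \<in> quadratic_maps\<close> by simp
qed simp

lemma polynomial_in_add:
  assumes "polynomial_in N \<phi> f" "polynomial_in N \<phi> g"
  shows "polynomial_in N \<phi> (\<lambda>Q. f Q + g Q)"
proof -
  obtain M a where f: "finite M" "\<And>Q. Q \<in> quadratic_maps \<Longrightarrow> f Q = (\<Sum>m\<in>M. a m * (\<Prod>i<N. \<phi> i Q ^ m i))"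
    using assms(1) unfolding polynomial_in_def by blast
  obtain L b where g: "finite L" "\<And>Q. Q \<in> quadratic_maps \<Longrightarrow> g Q = (\<Sum>m\<in>L. b m * (\<Prod>i<N. \<phi> i Q ^ m i))"
    using assms(2) unfolding polynomial_in_def by blast
  show ?thesis
    by (rule polynomial_inI[where T = "M <+> L" and a = "case_sum a b" and e = "case_sum id id"])
      (simp_all add: f g sum.Plus)
qed

lemma polynomial_in_mult:
  assumes "polynomial_in N \<phi> f" "polynomial_in N \<phi> g"
  shows "polynomial_in N \<phi> (\<lambda>Q. f Q * g Q)"
proof -
  obtain M a where f: "finite M" "\<And>Q. Q \<in> quadratic_maps \<Longrightarrow> f Q = (\<Sum>m\<in>M. a m * (\<Prod>i<N. \<phi> i Q ^ m i))"
    using assms(1) unfolding polynomial_in_def by blast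
  obtain L b where g: "finite L" "\<And>Q. Q \<in> quadratic_maps \<Longrightarrow> g Q = (\<Sum>m\<in>L. b m * (\<Prod>i<N. \<phi> i Q ^ m i))"
    using assms(2) unfolding polynomial_in_def by blast
  show ?thesis
    by (rule polynomial_inI[where T = "M \<times> L" and a = "\<lambda>(m, l). a m * b l" and e = "\<lambda>(m, l) i. m i + l i"])
      (auto simp: f g sum_product sum.cartesian_product power_add prod.distrib mult_ac intro!: sum.cong)
qed

lemma polynomial_in_sum:
  assumes "\<And>s. s \<in> S \<Longrightarrow> polynomial_in N \<phi> (f s)"
  shows "polynomial_in N \<phi> (\<lambda>Q. \<Sum>s\<in>S. f s Q)"
  using assms by (induction S rule: infinite_finite_induct) (auto intro: polynomial_in_const polynomial_in_add)

lemma polynomial_in_prod: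
  assumes "\<And>s. s \<in> S \<Longrightarrow> polynomial_in N \<phi> (f s)"
  shows "polynomial_in N \<phi> (\<lambda>Q. \<Prod>s\<in>S. f s Q)"
  using assms by (induction S rule: infinite_finite_induct) (auto intro: polynomial_in_const polynomial_in_mult)

section \<open>A hypersurface containing the degenerate quadratic maps\<close>

text \<open>
The degree \<open>DIM('a) + 1\<close> is the least one in which, by the pigeonhole principle, every monomial is
divisible by the square of a coordinate.
\<close>
definition exponents :: "('a::euclidean_space \<Rightarrow> nat) set" where
  "exponents = {\<alpha>. (\<forall>b. b \<notin> Basis \<longrightarrow> \<alpha> b = 0) \<and> (\<Sum>b\<in>Basis. \<alpha> b) = DIM('a) + 1}"

definition monomial :: "('a::euclidean_space \<Rightarrow> nat) \<Rightarrow> 'a \<Rightarrow> real" where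
  "monomial \<alpha> x = (\<Prod>b\<in>Basis. (x \<bullet> b) ^ \<alpha> b)"

definition pivot :: "('a::euclidean_space \<Rightarrow> nat) \<Rightarrow> 'a" where
  "pivot \<alpha> = (SOME b. b \<in> Basis \<and> \<alpha> b \<ge> 2)"

text \<open>
On exponents, this divides a monomial by \<open>x\<^sub>i\<^sup>2\<close> and multiplies it by \<open>x\<^sub>j x\<^sub>k\<close>.
\<close>
definition replace_square :: "'a \<Rightarrow> 'a \<Rightarrow> 'a \<Rightarrow> ('a::euclidean_space \<Rightarrow> nat) \<Rightarrow> 'a \<Rightarrow> nat" where
  "replace_square i j k \<alpha> b =
     \<alpha> b - (if b = i then 2 else 0) + (if b = j then 1 else 0) + (if b = k then 1 else 0)"

text \<open>
Row \<open>\<alpha>\<close> lists the coefficients of the polynomial \<open>x\<^sup>\<alpha> / x\<^sub>i\<^sup>2 \<cdot> Q\<^sub>i(x)\<close>, where \<open>i\<close> is the pivot of \<open>\<alpha>\<close>; the lemma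
\<open>macaulay_row\<close> below is this statement after evaluation at \<open>x\<close>.
\<close>
definition macaulay :: "('a::euclidean_space \<Rightarrow> 'a) \<Rightarrow> ('a \<Rightarrow> nat) \<Rightarrow> ('a \<Rightarrow> nat) \<Rightarrow> real" where
  "macaulay Q \<alpha> \<beta> = (\<Sum>j\<in>Basis. \<Sum>k\<in>Basis.
     if replace_square (pivot \<alpha>) j k \<alpha> = \<beta> then polar Q j k \<bullet> pivot \<alpha> else 0)"

lemma finite_exponents: "finite (exponents :: ('a::euclidean_space \<Rightarrow> nat) set)"
proof (rule finite_subset)
  show "exponents \<subseteq> {\<alpha>. \<forall>b::'a. (b \<in> Basis \<longrightarrow> \<alpha> b \<in> {..DIM('a) + 1}) \<and> (b \<notin> Basis \<longrightarrow> \<alpha> b = 0)}"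
  proof clarsimp
    fix \<alpha> :: "'a \<Rightarrow> nat" and b :: 'a
    assume "\<alpha> \<in> exponents"
    then have "(\<Sum>b\<in>Basis. \<alpha> b) = DIM('a) + 1" "b \<notin> Basis \<longrightarrow> \<alpha> b = 0"
      by (auto simp: exponents_def)
    then show "(b \<in> Basis \<longrightarrow> \<alpha> b \<le> Suc (DIM('a))) \<and> (b \<notin> Basis \<longrightarrow> \<alpha> b = 0)"
      using member_le_sum[of b Basis \<alpha>] by auto
  qed
  show "finite {\<alpha>. \<forall>b::'a. (b \<in> Basis \<longrightarrow> \<alpha> b \<in> {..DIM('a) + 1}) \<and> (b \<notin> Basis \<longrightarrow> \<alpha> b = 0)}"
    by (intro finite_set_of_finite_funs) auto
qed

lemma pivot:
  assumes "\<alpha> \<in> exponents"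
  shows "pivot \<alpha> \<in> Basis" "\<alpha> (pivot \<alpha>) \<ge> 2"
proof -
  have "\<exists>b. b \<in> Basis \<and> \<alpha> b \<ge> 2"
  proof (rule ccontr)
    assume "\<not> ?thesis"
    then have "(\<Sum>b\<in>Basis. \<alpha> b) \<le> (\<Sum>b\<in>(Basis::'a set). 1)"
      by (intro sum_mono) force
    then show False
      using assms by (simp add: exponents_def)
  qed
  then have "pivot \<alpha> \<in> Basis \<and> \<alpha> (pivot \<alpha>) \<ge> 2"
    unfolding pivot_def by (rule someI_ex)
  then show "pivot \<alpha> \<in> Basis" "\<alpha> (pivot \<alpha>) \<ge> 2"
    by simp_all
qed

lemma replace_square_in_exponents:
  assumes \<alpha>: "\<alpha> \<in> exponents" and ijk: "i \<in> Basis" "j \<in> Basis" "k \<in> Basis" and "\<alpha> i \<ge> 2"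
  shows "replace_square i j k \<alpha> \<in> exponents"
proof -
  have "(\<Sum>b\<in>Basis. \<alpha> b - (if b = i then 2 else 0)) = (\<Sum>b\<in>Basis. \<alpha> b) - (\<Sum>b\<in>Basis. if b = i then 2 else 0)"
    using assms(5) by (intro sum_subtractf_nat) auto
  moreover have "(\<Sum>b\<in>Basis. \<alpha> b) \<ge> \<alpha> i"
    using ijk by (intro member_le_sum) auto
  moreover have "(\<Sum>b\<in>Basis. replace_square i j k \<alpha> b) = (\<Sum>b\<in>Basis. \<alpha> b - (if b = i then 2 else 0)) + 2"
    unfolding replace_square_def sum.distrib using ijk by simp
  ultimately have "(\<Sum>b\<in>Basis. replace_square i j k \<alpha> b) = (\<Sum>b\<in>Basis. \<alpha> b)"
    using assms(5) ijk by simp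
  then show ?thesis
    using assms by (auto simp: exponents_def) (auto simp: replace_square_def)
qed

lemma replace_square_self: "\<alpha> i \<ge> 2 \<Longrightarrow> replace_square i i i \<alpha> = \<alpha>"
  by (auto simp: replace_square_def)

lemma monomial_replace_square:
  assumes "j \<in> Basis" "k \<in> Basis"
  shows "monomial (replace_square i j k \<alpha>) x =
     monomial (\<lambda>b. \<alpha> b - (if b = i then 2 else 0)) x * ((x \<bullet> j) * (x \<bullet> k))"
proof -
  have "(\<Prod>b\<in>Basis. (x \<bullet> b) ^ (if b = j then 1 else 0)) = x \<bullet> j" if "j \<in> Basis" for j
  proof -
    have "(\<Prod>b\<in>Basis. (x \<bullet> b) ^ (if b = j then 1 else 0)) = (\<Prod>b\<in>Basis. if b = j then x \<bullet> b else 1)"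
      by (intro prod.cong) auto
    then show ?thesis
      using that by simp
  qed
  then show ?thesis
    using assms by (simp add: monomial_def replace_square_def power_add prod.distrib del: power_Suc)
qed

lemma macaulay_row:
  assumes Q: "Q \<in> quadratic_maps" and \<alpha>: "\<alpha> \<in> exponents"
  shows "(\<Sum>\<beta>\<in>exponents. macaulay Q \<alpha> \<beta> * monomial \<beta> x) =
     monomial (\<lambda>b. \<alpha> b - (if b = pivot \<alpha> then 2 else 0)) x * (Q x \<bullet> pivot \<alpha>)"
proof -
  let ?i = "pivot \<alpha>"
  let ?m = "monomial (\<lambda>b. \<alpha> b - (if b = ?i then 2 else 0)) x"
  have "(\<Sum>\<beta>\<in>exponents. macaulay Q \<alpha> \<beta> * monomial \<beta> x) =
     (\<Sum>\<beta>\<in>exponents. \<Sum>j\<in>Basis. \<Sum>k\<in>Basis.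
       if replace_square ?i j k \<alpha> = \<beta> then (polar Q j k \<bullet> ?i) * monomial \<beta> x else 0)"
    by (auto simp: macaulay_def sum_distrib_right intro!: sum.cong)
  also have "\<dots> = (\<Sum>j\<in>Basis. \<Sum>k\<in>Basis. \<Sum>\<beta>\<in>exponents.
       if replace_square ?i j k \<alpha> = \<beta> then (polar Q j k \<bullet> ?i) * monomial \<beta> x else 0)"
    by (subst sum.swap, rule sum.cong[OF refl], rule sum.swap)
  also have "\<dots> = (\<Sum>j\<in>Basis. \<Sum>k\<in>Basis. (polar Q j k \<bullet> ?i) * monomial (replace_square ?i j k \<alpha>) x)"
    by (intro sum.cong refl)
      (simp add: finite_exponents replace_square_in_exponents[OF \<alpha>] pivot[OF \<alpha>])
  also have "\<dots> = (\<Sum>j\<in>Basis. \<Sum>k\<in>Basis. ?m * ((x \<bullet> j) * (x \<bullet> k) * (polar Q j k \<bullet> ?i)))"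
    by (intro sum.cong refl) (simp add: monomial_replace_square mult_ac)
  also have "\<dots> = ?m * ((\<Sum>j\<in>Basis. \<Sum>k\<in>Basis. ((x \<bullet> j) * (x \<bullet> k)) *\<^sub>R polar Q j k) \<bullet> ?i)"
    by (simp add: sum_distrib_left inner_sum_left)
  also have "(\<Sum>j\<in>Basis. \<Sum>k\<in>Basis. ((x \<bullet> j) * (x \<bullet> k)) *\<^sub>R polar Q j k) = Q x"
  proof -
    have "Q x = polar Q (\<Sum>j\<in>Basis. (x \<bullet> j) *\<^sub>R j) (\<Sum>k\<in>Basis. (x \<bullet> k) *\<^sub>R k)"
      by (simp add: euclidean_representation polar_diagonal[OF Q])
    also have "\<dots> = (\<Sum>(j, k)\<in>Basis \<times> Basis. polar Q ((x \<bullet> j) *\<^sub>R j) ((x \<bullet> k) *\<^sub>R k))"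
      by (rule bilinear_sum[OF bilinear_polar[OF Q]])
    also have "\<dots> = (\<Sum>j\<in>Basis. \<Sum>k\<in>Basis. ((x \<bullet> j) * (x \<bullet> k)) *\<^sub>R polar Q j k)"
      using bilinear_polar[OF Q]
      by (simp add: bilinear_lmul bilinear_rmul flip: sum.cartesian_product)
    finally show ?thesis by simp
  qed
  finally show ?thesis .
qed

text \<open>
The coordinatewise square witnesses that the hypersurface of degenerate maps is proper: substituting
\<open>x\<^sub>i\<^sup>2\<close> for \<open>x\<^sub>i\<^sup>2\<close> changes no monomial, so its Macaulay matrix is the identity.
\<close>
definition squaring :: "'a::euclidean_space \<Rightarrow> 'a" where
  "squaring x = (\<Sum>b\<in>Basis. (x \<bullet> b)\<^sup>2 *\<^sub>R b)"

lemma squaring_polar: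
  shows squaring_quadratic: "(squaring :: 'a::euclidean_space \<Rightarrow> 'a) \<in> quadratic_maps"
    and polar_squaring: "polar squaring u v = (\<Sum>b\<in>Basis. ((u \<bullet> b) * (v \<bullet> b)) *\<^sub>R (b::'a))"
proof -
  let ?B = "\<lambda>u v. \<Sum>b\<in>Basis. ((u \<bullet> b) * (v \<bullet> b)) *\<^sub>R (b::'a)"
  have B: "bilinear ?B" "\<And>u v. ?B u v = ?B v u" "\<And>x. squaring x = ?B x x"
    by (auto simp: bilinear_def linear_iff inner_add_left algebra_simps sum.distrib scaleR_sum_right
        squaring_def power2_eq_square)
  show "polar squaring u v = ?B u v"
    by (rule polar_eq[OF B])
  show "(squaring :: 'a \<Rightarrow> 'a) \<in> quadratic_maps"
    using B unfolding quadratic_maps_def by blast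
qed

lemma macaulay_squaring:
  assumes \<alpha>: "\<alpha> \<in> exponents"
  shows "macaulay squaring \<alpha> \<beta> = (if \<alpha> = \<beta> then 1 else 0)"
proof -
  let ?i = "pivot \<alpha>"
  have *: "polar squaring j k \<bullet> ?i = (if j = ?i then if k = ?i then 1 else 0 else 0)"
    if "j \<in> Basis" "k \<in> Basis" for j k
    using that pivot[OF \<alpha>] by (simp add: polar_squaring inner_sum_left_Basis inner_Basis)
  have "macaulay squaring \<alpha> \<beta> = (\<Sum>j\<in>Basis. \<Sum>k\<in>Basis.
     if j = ?i then if k = ?i then if \<alpha> = \<beta> then 1 else 0 else 0 else 0)"
    unfolding macaulay_def
  proof (intro sum.cong refl)
    fix j k :: 'a
    assume "j \<in> Basis" "k \<in> Basis"
    note jk = this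
    have "replace_square ?i ?i ?i \<alpha> = \<alpha>"
      using replace_square_self pivot(2)[OF \<alpha>] by blast
    then show "(if replace_square ?i j k \<alpha> = \<beta> then polar squaring j k \<bullet> ?i else 0) =
      (if j = ?i then if k = ?i then if \<alpha> = \<beta> then 1 else 0 else 0 else 0)"
      unfolding *[OF jk] by auto
  qed
  also have "\<dots> = (\<Sum>j\<in>Basis. if j = ?i then \<Sum>k\<in>Basis. if k = ?i then if \<alpha> = \<beta> then 1 else 0 else 0 else 0)"
    by (intro sum.cong refl) auto
  also have "\<dots> = (if \<alpha> = \<beta> then 1 else 0)"
    using pivot[OF \<alpha>] by simp
  finally show ?thesis .
qed

lemma polynomial_in_macaulay:
  assumes \<phi>: "\<And>u v w. u \<in> Basis \<Longrightarrow> v \<in> Basis \<Longrightarrow> w \<in> Basis \<Longrightarrow>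
       \<exists>i<N. \<forall>Q\<in>quadratic_maps. polar Q u v \<bullet> w = \<phi> i Q"
    and \<alpha>: "\<alpha> \<in> exponents"
  shows "polynomial_in N \<phi> (\<lambda>Q. macaulay Q \<alpha> \<beta>)"
  unfolding macaulay_def
proof (intro polynomial_in_sum)
  fix j k :: 'a
  assume "j \<in> Basis" "k \<in> Basis"
  then obtain i where i: "i < N" "\<And>Q. Q \<in> quadratic_maps \<Longrightarrow> polar Q j k \<bullet> pivot \<alpha> = \<phi> i Q"
    using \<phi> pivot[OF \<alpha>] by metis
  have "polynomial_in N \<phi> (\<lambda>Q. polar Q j k \<bullet> pivot \<alpha>)"
    by (rule polynomial_in_coordinate[where j = i, OF i(1)]) (rule i(2))
  then show "polynomial_in N \<phi> (\<lambda>Q. if replace_square (pivot \<alpha>) j k \<alpha> = \<beta> then polar Q j k \<bullet> pivot \<alpha> else 0)"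
    by (cases "replace_square (pivot \<alpha>) j k \<alpha> = \<beta>") (simp_all add: polynomial_in_const)
qed

text \<open>
The determinant of the Macaulay matrix, a multiple of the resultant. At a nonzero zero \<open>x\<close> of \<open>Q\<close>
all rows vanish on the vector of monomials at \<open>x\<close>, which is nonzero because it contains the pure
powers of the coordinates of \<open>x\<close>.
\<close>
lemma degeneracy_polynomial:
  obtains R :: "('a::euclidean_space \<Rightarrow> 'a) \<Rightarrow> real" where
    "polynomial_on_quadratic_maps R" "R squaring \<noteq> 0"
    "\<And>Q x. Q \<in> quadratic_maps \<Longrightarrow> x \<noteq> 0 \<Longrightarrow> Q x = 0 \<Longrightarrow> R Q = 0"
proof -
  let ?D = "exponents :: ('a \<Rightarrow> nat) set"
  define d where "d = card ?D"
  obtain e where e: "bij_betw e {0..<d} ?D"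
    unfolding d_def using ex_bij_betw_nat_finite[OF finite_exponents] by blast
  have eD: "e r \<in> ?D" if "r < d" for r
    using bij_betwE[OF e] that by auto
  define A where "A = (\<lambda>Q :: 'a \<Rightarrow> 'a. mat d d (\<lambda>(r, c). macaulay Q (e r) (e c)))"
  have A: "A Q \<in> carrier_mat d d" for Q
    by (simp add: A_def)
  show thesis
  proof (rule that[of "\<lambda>Q. det (A Q)"])
    obtain N \<phi> where lc: "linear_coordinates N (\<phi> :: nat \<Rightarrow> ('a \<Rightarrow> 'a) \<Rightarrow> real)"
      and \<phi>: "\<And>u v w. u \<in> Basis \<Longrightarrow> v \<in> Basis \<Longrightarrow> w \<in> Basis \<Longrightarrow>
       \<exists>i<N. \<forall>Q\<in>quadratic_maps. polar Q u v \<bullet> w = \<phi> i Q"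
      by (rule quadratic_maps_coordinates) (rule that; assumption)
    have "(\<lambda>Q. det (A Q)) = (\<lambda>Q. \<Sum>p | p permutes {0..<d}. signof p *
       (\<Prod>r = 0..<d. macaulay Q (e r) (e (p r))))"
      by (auto simp: det_def A_def permutes_in_image intro!: ext sum.cong prod.cong)
    moreover have "polynomial_in N \<phi> \<dots>"
      by (intro polynomial_in_sum polynomial_in_mult polynomial_in_prod polynomial_in_const polynomial_in_macaulay \<phi> eD) auto
    ultimately have "polynomial_in N \<phi> (\<lambda>Q. det (A Q))"
      by metis
    then show "polynomial_on_quadratic_maps (\<lambda>Q. det (A Q))"
      using lc unfolding polynomial_on_quadratic_maps_def polynomial_in_def by blast
  next
    have "A squaring = 1\<^sub>m d"
      using e by (intro eq_matI) (auto simp: A_def macaulay_squaring eD bij_betw_def inj_on_def)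
    then show "det (A squaring) \<noteq> 0"
      by simp
  next
    fix Q :: "'a \<Rightarrow> 'a" and x :: 'a
    assume Q: "Q \<in> quadratic_maps" and x: "x \<noteq> 0" "Q x = 0"
    define w where "w = vec d (\<lambda>c. monomial (e c) x)"
    have w: "w \<in> carrier_vec d"
      by (simp add: w_def)
    have "A Q *\<^sub>v w = 0\<^sub>v d"
    proof (rule eq_vecI)
      fix r
      assume "r < dim_vec (0\<^sub>v d :: real vec)"
      then have r: "r < d" by simp
      then have "(A Q *\<^sub>v w) $ r = (\<Sum>c = 0..<d. macaulay Q (e r) (e c) * monomial (e c) x)"
        by (simp add: A_def w_def scalar_prod_def)
      also have "\<dots> = (\<Sum>\<beta>\<in>?D. macaulay Q (e r) \<beta> * monomial \<beta> x)"
        by (rule sum.reindex_bij_betw[OF e])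
      also have "\<dots> = 0"
        by (simp add: macaulay_row[OF Q eD[OF r]] x)
      finally show "(A Q *\<^sub>v w) $ r = 0\<^sub>v d $ r"
        using r by simp
    qed (simp add: A_def)
    moreover have "w \<noteq> 0\<^sub>v d"
    proof -
      obtain b where b: "b \<in> Basis" "x \<bullet> b \<noteq> 0"
        using x euclidean_all_zero_iff by blast
      define \<beta> where "\<beta> = (\<lambda>b'. if b' = b then DIM('a) + 1 else 0)"
      have "\<beta> \<in> ?D"
        using b by (auto simp: exponents_def \<beta>_def)
      then obtain c where c: "c < d" "e c = \<beta>"
        using e by (auto simp: bij_betw_def image_iff set_eq_iff) (metis atLeastLessThan_iff)
      have "monomial \<beta> x \<noteq> 0"
        using b by (auto simp: monomial_def \<beta>_def)
      then have "w $ c \<noteq> 0\<^sub>v d $ c"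
        using c by (simp add: w_def)
      then show ?thesis
        by auto
    qed
    ultimately show "det (A Q) = 0"
      using det_0_iff_vec_prod_zero[OF A] w by blast
  qed
qed

section \<open>Generic blow-up\<close>

theorem mainTheorem1:
  shows "\<exists>Z :: ('a::euclidean_space \<Rightarrow> 'a) set.
           algebraic_subvariety Z \<and> Z \<subset> quadratic_maps \<and>
           (\<forall>Q \<in> quadratic_maps - Z. \<exists>A. blows_up_in_finite_time Q A)"
proof -
  obtain R :: "('a \<Rightarrow> 'a) \<Rightarrow> real" where R: "polynomial_on_quadratic_maps R" "R squaring \<noteq> 0"
    "\<And>Q x. Q \<in> quadratic_maps \<Longrightarrow> x \<noteq> 0 \<Longrightarrow> Q x = 0 \<Longrightarrow> R Q = 0"
    by (rule degeneracy_polynomial) (rule that; assumption)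
  define Z where "Z = {Q \<in> quadratic_maps. R Q = 0}"
  have "algebraic_subvariety Z"
    unfolding algebraic_subvariety_def Z_def using R(1) by (intro exI[of _ "{R}"]) auto
  moreover have "Z \<subset> quadratic_maps"
    using R(2) squaring_quadratic by (auto simp: Z_def)
  moreover have "\<exists>A. blows_up_in_finite_time Q A" if "Q \<in> quadratic_maps - Z" for Q
  proof -
    have Q: "Q \<in> quadratic_maps" and "\<And>x. x \<noteq> 0 \<Longrightarrow> Q x \<noteq> 0"
      using that R(3)[of Q] by (auto simp: Z_def)
    then obtain A l where "A \<noteq> 0" "l > 0" "Q A = l *\<^sub>R A"
      by (rule quadratic_ray)
    then show ?thesis
      using blows_up_along_ray[OF Q] by blast
  qed
  ultimately show ?thesis
    by blast
qed

end
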